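(* Let $\alpha\in\mathbb{R}\setminus\mathbb{Q}$ and let $(q_\ell)_{\ell\ge 0}$ be the sequence of denominators of the principal convergents of $\alpha$. Let $N\in\mathbb{N}$ and $\varepsilon>0$ be such that $0<2\varepsilon<\|q_2\alpha\|$. Suppose that $$\frac{1}{2\varepsilon}\le q_\ell\le N$$ for some integer $\ell$. Then $$\lfloor\varepsilon N\rfloor\ \le\ \#\{n\in\mathbb{N}:\|n\alpha\|<\varepsilon,\ n\le N\}\ \le\ 32\,\varepsilon N.$$
   Context: $\|x\|$ denotes the distance from $x\in\mathbb{R}$ to the nearest integer. For irrational $\alpha=[a_0;a_1,a_2,\dots]$ (simple continued fraction expansion), $q_\ell$ is the denominator of $[a_0;a_1,\dots,a_\ell]$ in lowest terms (so $q_0=1$, $q_1=a_1$, $q_{\ell+1}=a_{\ell+1}q_\ell+q_{\ell-1}$). *)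

theory Defs
  imports Complex_Main
begin

definition dist_nearest_int :: "real \<Rightarrow> real"
  where "dist_nearest_int x = \<bar>x - of_int (round x)\<bar>"

text \<open>
  Simple continued fraction expansion of a real number, via its complete quotients.
  For irrational \<open>\<alpha>\<close> no complete quotient is an integer, so the reciprocals below are
  always genuine; for rational \<open>\<alpha>\<close> the values past the end of the expansion carry
  no meaning.
\<close>

fun complete_quotient :: "real \<Rightarrow> nat \<Rightarrow> real"
  where
    "complete_quotient \<alpha> 0 = \<alpha>"
  | "complete_quotient \<alpha> (Suc l) = 1 / frac (complete_quotient \<alpha> l)"

definition partial_quotient :: "real \<Rightarrow> nat \<Rightarrow> int"
  where "partial_quotient \<alpha> l = \<lfloor>complete_quotient \<alpha> l\<rfloor>"

text \<open>The value of \<open>[a\<^sub>0; a\<^sub>1, \<dots>, a\<^sub>l]\<close>; the equation for \<open>[]\<close> is a dummy.\<close>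

fun cf_value :: "int list \<Rightarrow> rat"
  where
    "cf_value [] = 0"
  | "cf_value [a] = of_int a"
  | "cf_value (a # b # as) = of_int a + 1 / cf_value (b # as)"

definition cf_convergent :: "real \<Rightarrow> nat \<Rightarrow> rat"
  where "cf_convergent \<alpha> l = cf_value (map (partial_quotient \<alpha>) [0..<Suc l])"

text \<open>\<open>quotient_of\<close> yields the representation in lowest terms with positive denominator.\<close>

definition cf_denom :: "real \<Rightarrow> nat \<Rightarrow> int"
  where "cf_denom \<alpha> l = snd (quotient_of (cf_convergent \<alpha> l))"

end

theory Submission
  imports Defs "HOL-Library.FuncSet"
begin

text \<open>
  Lower bound. An arc of length \<open>\<epsilon>\<close> placed uniformly at random on the circle contains on average
  \<open>(N + 1)\<epsilon>\<close> of the \<open>N + 1\<close> points \<open>n\<alpha>\<close>, \<open>0 \<le> n \<le> N\<close>, so some arc contains more than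
  \<open>\<lfloor>\<epsilon>N\<rfloor>\<close> of them. Subtracting the smallest index in that arc from the others turns each of them into
  an \<open>n\<close> between 1 and \<open>N\<close> with \<open>n\<alpha>\<close> closer than \<open>\<epsilon>\<close> to an integer
  (\<open>card_near_return_times_ge\<close>).

  Upper bound. Let \<open>\<bar>\<alpha> - p/q\<bar> \<le> 1/q\<^sup>2\<close> with \<open>p\<close>, \<open>q\<close> coprime. Over a block of \<open>q\<close> consecutive
  \<open>n\<close>, the accumulated drift between \<open>n\<alpha>\<close> and \<open>np/q\<close> varies by at most \<open>1/q\<close>, while the
  residues of \<open>np\<close> modulo \<open>q\<close> are distinct. Hence the \<open>n\<close> in the block with \<open>n\<alpha>\<close> within
  \<open>\<epsilon>\<close> of an integer inject into the integers of an interval of length \<open>2\<epsilon>q + 1\<close>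
  (\<open>card_block_near_return_times_le\<close>). Since \<open>2\<epsilon>q \<ge> 1\<close>, there are at most \<open>6\<epsilon>q\<close> per block,
  and since \<open>q \<le> N\<close>, at most \<open>2N/q\<close> blocks are needed, which gives \<open>12\<epsilon>N\<close>
  (\<open>card_near_return_times_le\<close>).

  The approximation \<open>p/q\<close> is the convergent whose denominator lies between \<open>1/(2\<epsilon>)\<close> and \<open>N\<close>; that
  it has the required quality is the classical fact \<open>cf_denom_approximation\<close>.
\<close>

section \<open>Distance to the nearest integer\<close>

lemma dist_nearest_int_le: "dist_nearest_int x \<le> \<bar>x - of_int m\<bar>"
  unfolding dist_nearest_int_def
  using round_diff_minimal[of x m] by (simp add: abs_minus_commute)

lemma dist_nearest_int_le_half: "dist_nearest_int x \<le> 1 / 2"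
  unfolding dist_nearest_int_def
  using of_int_round_abs_le[of x] by (simp add: abs_minus_commute)

lemma dvd_abs_less_imp_zero:
  fixes d i :: int
  assumes "d dvd i" and "\<bar>i\<bar> < d"
  shows "i = 0"
  using assms dvd_imp_le_int[of i d] by auto

section \<open>The lower bound by pigeonhole\<close>

text \<open>
  The averaging over arcs is done on a grid of mesh \<open>1/K\<close>. With \<open>L = \<lfloor>\<epsilon>K\<rfloor>\<close>, each point \<open>n\<alpha>\<close>
  is counted once for each of the \<open>L\<close> cyclic windows of \<open>L\<close> consecutive cells that contain its cell;
  the window that starts at cell \<open>j\<close> is the fibre of \<open>f\<close> over \<open>j\<close>. Cutting the circle
  into disjoint arcs instead would round \<open>\<epsilon>\<close> down to the reciprocal of an integer and lose the
  constant 1 in front of \<open>\<epsilon>N\<close>.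
\<close>

lemma card_near_return_times_ge:
  fixes \<alpha> \<epsilon> :: real and N :: nat
  assumes "0 < \<epsilon>" and "\<epsilon> \<le> 1"
  shows "\<lfloor>\<epsilon> * real N\<rfloor> \<le> int (card {n::nat. 1 \<le> n \<and> n \<le> N \<and> dist_nearest_int (real n * \<alpha>) < \<epsilon>})"
proof -
  define T where "T = {n::nat. 1 \<le> n \<and> n \<le> N \<and> dist_nearest_int (real n * \<alpha>) < \<epsilon>}"
  \<comment> \<open>So fine a grid that rounding \<open>\<epsilon>K\<close> down costs less than the gain from counting \<open>n = 0\<close>.\<close>
  obtain K :: nat where K: "real (N + 1) / \<epsilon> \<le> real K"
    using real_arch_simple by blast
  have "0 < real (N + 1) / \<epsilon>"
    using assms by simp
  with K have K0: "0 < K"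
    by (metis less_le_trans of_nat_0_less_iff)
  define L where "L = nat \<lfloor>\<epsilon> * real K\<rfloor>"
  have L_le: "real L \<le> \<epsilon> * real K"
    using assms by (simp add: L_def)
  have L_gt: "\<epsilon> * real K - 1 < real L"
    unfolding L_def by linarith
  have "\<epsilon> * real K \<le> 1 * real K"
    by (intro mult_right_mono) (use assms in auto)
  with L_le have L_le_K: "L \<le> K"
    by simp
  define f where "f = (\<lambda>(n::nat, i::nat). (\<lfloor>real K * (real n * \<alpha>)\<rfloor> - int i) mod int K)"
  define D where "D = {..N} \<times> {..<L}"
  have fin_D: "finite D" and card_D: "card D = (N + 1) * L"
    unfolding D_def by (simp_all add: card_cartesian_product)
  define m where "m = nat \<lfloor>\<epsilon> * real N\<rfloor>"
  have m_le: "real m \<le> \<epsilon> * real N"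
    using assms unfolding m_def by simp
  have "real (m * K) \<le> \<epsilon> * real N * real K"
    using m_le by (simp add: mult_right_mono)
  also have "\<dots> \<le> real (N + 1) * (\<epsilon> * real K - 1)"
    using K assms by (simp add: field_simps)
  also have "\<dots> < real (N + 1) * real L"
    using L_gt by (intro mult_strict_left_mono) auto
  finally have big: "m * K < (N + 1) * L"
    by (metis of_nat_less_iff of_nat_mult)
  have "f \<in> D \<rightarrow> {0..<int K}"
    using K0 by (auto simp: f_def)
  then have "\<exists>j\<in>{0..<int K}. card D \<le> card (f -` {j} \<inter> D) * card {0..<int K}"
    using K0 fin_D by (intro pigeonhole_card) auto
  then obtain j where "(N + 1) * L \<le> card (f -` {j} \<inter> D) * K"
    by (auto simp: card_D)
  with big have "m * K < card (f -` {j} \<inter> D) * K"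
    by linarith
  then have j: "m < card (f -` {j} \<inter> D)"
    by simp
  define F where "F = f -` {j} \<inter> D"
  have fin_F: "finite F"
    using fin_D by (simp add: F_def)
  have fibre: "\<exists>z. \<lfloor>real K * (real n * \<alpha>)\<rfloor> - int i = \<lfloor>real K * (real n' * \<alpha>)\<rfloor> - int i' + int K * z"
    if "(n, i) \<in> F" "(n', i') \<in> F" for n i n' i'
  proof -
    have "(\<lfloor>real K * (real n * \<alpha>)\<rfloor> - int i) mod int K = (\<lfloor>real K * (real n' * \<alpha>)\<rfloor> - int i') mod int K"
      using that by (simp add: F_def f_def)
    then show ?thesis
      by (metis mod_eqE add.commute diff_eq_eq)
  qed
  have inj: "inj_on fst F"
  proof (rule inj_onI, clarsimp)
    fix n i i'
    assume *: "(n, i) \<in> F" "(n, i') \<in> F"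
    from fibre[OF this] have "int K dvd int i' - int i"
      by (auto simp: dvd_def algebra_simps)
    moreover have "i < K" "i' < K"
      using * L_le_K by (auto simp: F_def D_def)
    then have "\<bar>int i' - int i\<bar> < int K"
      by linarith
    ultimately have "int i' - int i = 0"
      by (rule dvd_abs_less_imp_zero)
    then show "i = i'"
      by simp
  qed
  define G where "G = fst ` F"
  have card_G: "m < card G"
    using j inj by (simp add: G_def F_def card_image)
  have fin_G: "finite G"
    using fin_F by (simp add: G_def)
  define n0 where "n0 = Min G"
  have "G \<noteq> {}"
    using card_G by auto
  then have n0: "n0 \<in> G" and n0_le: "\<And>n. n \<in> G \<Longrightarrow> n0 \<le> n"
    using fin_G by (simp_all add: n0_def)
  have "(\<lambda>n. n - n0) ` (G - {n0}) \<subseteq> T"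
  proof (rule image_subsetI)
    fix n assume "n \<in> G - {n0}"
    then have n: "n \<in> G" "n \<noteq> n0"
      by simp_all
    then have n_gt: "n0 < n"
      using n0_le by (simp add: le_neq_implies_less)
    obtain i i0 where i: "(n, i) \<in> F" "(n0, i0) \<in> F"
      using n n0 by (auto simp: G_def)
    obtain z where z: "\<lfloor>real K * (real n * \<alpha>)\<rfloor> - int i = \<lfloor>real K * (real n0 * \<alpha>)\<rfloor> - int i0 + int K * z"
      using fibre[OF i] by blast
    have iL: "i < L" "i0 < L" "n \<le> N"
      using i by (auto simp: F_def D_def)
    have z': "real_of_int \<lfloor>real K * (real n * \<alpha>)\<rfloor> - real i
        = real_of_int \<lfloor>real K * (real n0 * \<alpha>)\<rfloor> - real i0 + real K * real_of_int z"
      using arg_cong[OF z, of real_of_int] by simp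
    have "real K * (real (n - n0) * \<alpha> - real_of_int z)
        = real K * (real n * \<alpha>) - real K * (real n0 * \<alpha>) - real K * real_of_int z"
      using n_gt by (simp add: of_nat_diff algebra_simps)
    also have "\<bar>\<dots>\<bar> < real L"
      using z' iL by linarith
    finally have "real K * \<bar>real (n - n0) * \<alpha> - real_of_int z\<bar> < real L"
      by (simp add: abs_mult)
    also note L_le
    finally have "\<bar>real (n - n0) * \<alpha> - real_of_int z\<bar> < \<epsilon>"
      using K0 by (simp add: mult.commute)
    then have "dist_nearest_int (real (n - n0) * \<alpha>) < \<epsilon>"
      using dist_nearest_int_le le_less_trans by blast
    then show "n - n0 \<in> T"
      using n_gt iL unfolding T_def by auto
  qed
  moreover have "finite T"
    by (rule finite_subset[of _ "{..N}"]) (auto simp: T_def)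
  ultimately have "card ((\<lambda>n. n - n0) ` (G - {n0})) \<le> card T"
    by (rule card_mono[rotated])
  moreover have "inj_on (\<lambda>n. n - n0) (G - {n0})"
    using n0_le by (auto intro!: inj_onI) (metis eq_diff_iff)
  ultimately have "card (G - {n0}) \<le> card T"
    by (simp add: card_image)
  then have "m \<le> card T"
    using card_G n0 fin_G by simp
  then show ?thesis
    using assms unfolding m_def T_def by (simp add: nat_le_iff)
qed

section \<open>The upper bound from a good rational approximation\<close>

lemma card_int_near_le:
  fixes c R :: real
  assumes "0 \<le> R"
  shows "real (card {k::int. \<bar>of_int k - c\<bar> < R}) \<le> 2 * R + 1"
    and "finite {k::int. \<bar>of_int k - c\<bar> < R}"
proof -
  have sub: "{k::int. \<bar>of_int k - c\<bar> < R} \<subseteq> {\<lceil>c - R\<rceil>..\<lfloor>c + R\<rfloor>}"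
    by (auto simp: ceiling_le_iff le_floor_iff)
  then show "finite {k::int. \<bar>of_int k - c\<bar> < R}"
    by (rule finite_subset) simp
  have "card {k::int. \<bar>of_int k - c\<bar> < R} \<le> nat (\<lfloor>c + R\<rfloor> - \<lceil>c - R\<rceil> + 1)"
    using card_mono[OF _ sub] by simp
  moreover have "real (nat (\<lfloor>c + R\<rfloor> - \<lceil>c - R\<rceil> + 1)) \<le> 2 * R + 1"
    using assms by (cases "0 \<le> \<lfloor>c + R\<rfloor> - \<lceil>c - R\<rceil> + 1") linarith+
  ultimately show "real (card {k::int. \<bar>of_int k - c\<bar> < R}) \<le> 2 * R + 1"
    by linarith
qed

text \<open>
  To an \<open>n\<close> with nearest integer \<open>r\<close> to \<open>n\<alpha>\<close> belongs the integer \<open>np - rq\<close>. It determines \<open>n\<close>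
  modulo \<open>q\<close>, hence within the block, and it equals \<open>q(n\<alpha> - r)\<close>, of size below \<open>\<epsilon>q\<close>, plus
  the drift \<open>n(p - q\<alpha>)\<close>, which varies by at most 1 over the block.
\<close>

lemma card_block_near_return_times_le:
  fixes \<alpha> \<epsilon> :: real and p :: int and q s :: nat
  assumes cop: "coprime p (int q)" and q: "0 < q"
    and approx: "\<bar>\<alpha> - of_int p / real q\<bar> \<le> 1 / real q ^ 2"
    and \<epsilon>: "0 < \<epsilon>"
    and S: "S \<subseteq> {s..<s + q}" and near: "\<And>n. n \<in> S \<Longrightarrow> dist_nearest_int (real n * \<alpha>) < \<epsilon>"
  shows "real (card S) \<le> 2 * \<epsilon> * real q + 2"
proof -
  define k where "k = (\<lambda>n::nat. int n * p - round (real n * \<alpha>) * int q)"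
  define \<delta> where "\<delta> = of_int p - real q * \<alpha>"
  \<comment> \<open>The drift at the middle of the block, from which the drift deviates by at most \<open>1/2\<close>.\<close>
  define c where "c = (real s + real q / 2) * \<delta>"
  have \<delta>: "real q * \<bar>\<delta>\<bar> \<le> 1"
  proof -
    have "\<delta> = - (real q * (\<alpha> - of_int p / real q))"
      using q by (simp add: \<delta>_def field_simps)
    then have "real q * \<bar>\<delta>\<bar> = real q ^ 2 * \<bar>\<alpha> - of_int p / real q\<bar>"
      by (simp add: abs_mult power2_eq_square)
    also have "\<dots> \<le> real q ^ 2 * (1 / real q ^ 2)"
      by (intro mult_left_mono approx) simp
    finally show ?thesis
      using q by simp
  qed
  have "inj_on k S"
  proof (rule inj_onI)
    fix n n' assume n: "n \<in> S" "n' \<in> S" and "k n = k n'"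
    then have "(int n - int n') * p = (round (real n * \<alpha>) - round (real n' * \<alpha>)) * int q"
      by (simp add: k_def algebra_simps)
    then have "int q dvd (int n - int n') * p"
      by simp
    then have "int q dvd int n - int n'"
      using cop by (simp add: coprime_dvd_mult_left_iff coprime_commute)
    moreover have "n \<in> {s..<s + q}" "n' \<in> {s..<s + q}"
      using n S by blast+
    then have "\<bar>int n - int n'\<bar> < int q"
      by auto
    ultimately have "int n - int n' = 0"
      by (rule dvd_abs_less_imp_zero)
    then show "n = n'"
      by simp
  qed
  moreover have "k ` S \<subseteq> {k. \<bar>of_int k - c\<bar> < \<epsilon> * real q + 1 / 2}"
  proof clarify
    fix n assume n: "n \<in> S"
    have dist: "\<bar>real n * \<alpha> - of_int (round (real n * \<alpha>))\<bar> < \<epsilon>"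
      using near[OF n] by (simp add: dist_nearest_int_def)
    have "n \<in> {s..<s + q}"
      using n S by blast
    then have "real s \<le> real n" "real n \<le> real s + real q"
      by (auto simp flip: of_nat_add)
    then have "\<bar>real n - (real s + real q / 2)\<bar> \<le> real q / 2"
      by linarith
    then have "\<bar>real n - (real s + real q / 2)\<bar> * \<bar>\<delta>\<bar> \<le> real q / 2 * \<bar>\<delta>\<bar>"
      by (rule mult_right_mono) simp
    then have 1: "\<bar>(real n - (real s + real q / 2)) * \<delta>\<bar> \<le> 1 / 2"
      using \<delta> by (simp add: abs_mult)
    have 2: "\<bar>real q * (real n * \<alpha> - of_int (round (real n * \<alpha>)))\<bar> < \<epsilon> * real q"
      using dist q by (simp add: abs_mult mult.commute)
    have "of_int (k n) - c = (real n - (real s + real q / 2)) * \<delta>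
        + real q * (real n * \<alpha> - of_int (round (real n * \<alpha>)))"
      by (simp add: k_def c_def \<delta>_def algebra_simps)
    then show "\<bar>of_int (k n) - c\<bar> < \<epsilon> * real q + 1 / 2"
      using 1 2 by linarith
  qed
  ultimately have "card S \<le> card {k::int. \<bar>of_int k - c\<bar> < \<epsilon> * real q + 1 / 2}"
    using card_int_near_le(2)[of "\<epsilon> * real q + 1 / 2" c] \<epsilon>
    by (intro card_inj_on_le) auto
  also have "real \<dots> \<le> 2 * (\<epsilon> * real q + 1 / 2) + 1"
    using \<epsilon> by (intro card_int_near_le(1)) simp
  finally show ?thesis
    by simp
qed

lemma card_near_return_times_le:
  fixes \<alpha> \<epsilon> :: real and p :: int and q N :: nat
  assumes cop: "coprime p (int q)" and q: "0 < q"
    and approx: "\<bar>\<alpha> - of_int p / real q\<bar> \<le> 1 / real q ^ 2"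
    and \<epsilon>: "0 < \<epsilon>" and q_ge: "1 \<le> 2 * \<epsilon> * real q" and q_le: "q \<le> N"
  shows "real (card {n::nat. 1 \<le> n \<and> n \<le> N \<and> dist_nearest_int (real n * \<alpha>) < \<epsilon>}) \<le> 12 * \<epsilon> * real N"
proof -
  define T where "T = {n::nat. 1 \<le> n \<and> n \<le> N \<and> dist_nearest_int (real n * \<alpha>) < \<epsilon>}"
  have "T \<subseteq> (\<Union>b\<le>N div q. T \<inter> {b * q..<b * q + q})"
  proof
    fix n assume n: "n \<in> T"
    then have "n div q \<le> N div q"
      by (simp add: T_def div_le_mono)
    moreover have "n \<in> {n div q * q..<n div q * q + q}"
      using q dividend_less_div_times[of q n] by (simp add: add.commute)
    ultimately show "n \<in> (\<Union>b\<le>N div q. T \<inter> {b * q..<b * q + q})"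
      using n by blast
  qed
  then have "card T \<le> card (\<Union>b\<le>N div q. T \<inter> {b * q..<b * q + q})"
    by (rule card_mono[rotated]) auto
  also have "\<dots> \<le> (\<Sum>b\<le>N div q. card (T \<inter> {b * q..<b * q + q}))"
    by (rule card_UN_le) simp
  finally have "real (card T) \<le> (\<Sum>b\<le>N div q. real (card (T \<inter> {b * q..<b * q + q})))"
    by (metis of_nat_le_iff of_nat_sum)
  also have "\<dots> \<le> (\<Sum>b\<le>N div q. 6 * \<epsilon> * real q)"
  proof (rule sum_mono)
    fix b
    have "real (card (T \<inter> {b * q..<b * q + q})) \<le> 2 * \<epsilon> * real q + 2"
      by (rule card_block_near_return_times_le[OF cop q approx \<epsilon>]) (auto simp: T_def)
    then show "real (card (T \<inter> {b * q..<b * q + q})) \<le> 6 * \<epsilon> * real q"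
      using q_ge by simp
  qed
  also have "\<dots> = 6 * \<epsilon> * real (N div q * q + q)"
    by (simp add: algebra_simps)
  also have "\<dots> \<le> 6 * \<epsilon> * real (2 * N)"
  proof (intro mult_left_mono)
    have "N div q * q + q \<le> 2 * N"
      using q_le div_times_less_eq_dividend[of N q] by linarith
    then show "real (N div q * q + q) \<le> real (2 * N)"
      by (rule of_nat_mono)
  qed (use \<epsilon> in simp)
  finally show ?thesis
    by (simp add: T_def)
qed

section \<open>Convergents are good approximations\<close>

lemma complete_quotient_Suc_front:
  "complete_quotient \<alpha> (Suc l) = complete_quotient (1 / frac \<alpha>) l"
  by (induction l) auto

text \<open>
  The expansion is unfolded at its first term, as \<open>cf_value\<close> does. This replaces \<open>\<alpha>\<close> by its first
  complete quotient \<open>1 / frac \<alpha>\<close>, so inductions on the index have to generalise over \<open>\<alpha>\<close>.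
\<close>

lemma cf_convergent_Suc_front:
  "cf_convergent \<alpha> (Suc l) = of_int \<lfloor>\<alpha>\<rfloor> + 1 / cf_convergent (1 / frac \<alpha>) l"
proof -
  have shift: "partial_quotient \<alpha> (Suc i) = partial_quotient (1 / frac \<alpha>) i" for i
    unfolding partial_quotient_def complete_quotient_Suc_front ..
  have "cf_convergent \<alpha> (Suc l) = cf_value (partial_quotient \<alpha> 0
      # map (partial_quotient (1 / frac \<alpha>)) [0..<Suc l])"
    unfolding cf_convergent_def map_upt_Suc[of _ "Suc l"] shift ..
  also have "\<dots> = of_int (partial_quotient \<alpha> 0) + 1 / cf_convergent (1 / frac \<alpha>) l"
    unfolding cf_convergent_def map_upt_Suc[of _ l] by simp
  finally show ?thesis
    by (simp add: partial_quotient_def)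
qed

lemma inverse_frac_irrational:
  assumes "\<alpha> \<notin> \<rat>"
  shows "1 / frac \<alpha> \<notin> \<rat>" and "1 < 1 / frac \<alpha>"
proof -
  have "frac \<alpha> \<notin> \<rat>"
    using assms unfolding frac_def by (metis Rats_add Rats_of_int diff_add_cancel)
  then show "1 / frac \<alpha> \<notin> \<rat>"
    by (metis Rats_inverse inverse_eq_divide inverse_inverse_eq)
  from \<open>frac \<alpha> \<notin> \<rat>\<close> have "frac \<alpha> \<noteq> 0"
    by (metis Rats_0)
  then have "0 < frac \<alpha>" "frac \<alpha> < 1"
    using frac_ge_0[of \<alpha>] frac_lt_1[of \<alpha>] by linarith+
  then show "1 < 1 / frac \<alpha>"
    by simp
qed

text \<open>
  Here \<open>p'/q'\<close> is the preceding convergent (formally \<open>1/0\<close> at index 0) and \<open>x\<close> the next complete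
  quotient, so that \<open>\<alpha> = (xp + p') / (xq + q')\<close> is the usual unimodular transformation. A term \<open>a\<close> in
  front of the expansion maps \<open>(p, q)\<close> to \<open>(ap + q, p)\<close>: the old numerators become the new
  denominators. This is why the signs of the numerators are carried along; they are known when
  \<open>\<alpha> > 1\<close>, which every complete quotient after the first satisfies.
\<close>

lemma cf_convergent_moebius:
  assumes "\<alpha> \<notin> \<rat>"
  shows "\<exists>p q p' q' :: int. 1 \<le> q \<and> 0 \<le> q' \<and> \<bar>p * q' - p' * q\<bar> = 1
    \<and> (1 < \<alpha> \<longrightarrow> 1 \<le> p \<and> 0 \<le> p')
    \<and> cf_convergent \<alpha> l = of_int p / of_int q
    \<and> (\<exists>x > 1. \<alpha> * (x * of_int q + of_int q') = x * of_int p + of_int p')"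
  using assms
proof (induction l arbitrary: \<alpha>)
  case 0
  define x where "x = 1 / frac \<alpha>"
  have "1 < x"
    using inverse_frac_irrational(2)[OF 0] by (simp add: x_def)
  moreover from this have "frac \<alpha> * x = 1"
    by (metis x_def divide_eq_0_iff mult.commute nonzero_eq_divide_eq not_one_less_zero)
  then have "\<alpha> * x = x * of_int \<lfloor>\<alpha>\<rfloor> + 1"
    by (simp add: frac_def algebra_simps)
  moreover have "cf_convergent \<alpha> 0 = of_int \<lfloor>\<alpha>\<rfloor> / of_int 1"
    by (simp add: cf_convergent_def partial_quotient_def)
  ultimately show ?case
    by (intro exI[of _ "\<lfloor>\<alpha>\<rfloor>"] exI[of _ 1] exI[of _ 0]) auto
next
  case (Suc l)
  define \<beta> where "\<beta> = 1 / frac \<alpha>"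
  have \<beta>: "\<beta> \<notin> \<rat>" "1 < \<beta>"
    using inverse_frac_irrational[OF Suc.prems] by (simp_all add: \<beta>_def)
  from Suc.IH[OF \<beta>(1)] \<beta>(2) obtain p q p' q' :: int and x :: real where
    *: "1 \<le> q" "0 \<le> q'" "\<bar>p * q' - p' * q\<bar> = 1" "1 \<le> p" "0 \<le> p'"
       "cf_convergent \<beta> l = of_int p / of_int q" "1 < x"
       "\<beta> * (x * of_int q + of_int q') = x * of_int p + of_int p'"
    by blast
  define a where "a = \<lfloor>\<alpha>\<rfloor>"
  have \<alpha>: "\<alpha> = of_int a + 1 / \<beta>"
    by (simp add: a_def \<beta>_def frac_def)
  have "\<bar>(a * p + q) * p' - (a * p' + q') * p\<bar> = \<bar>- (p * q' - p' * q)\<bar>"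
    by (simp add: algebra_simps)
  then have det: "\<bar>(a * p + q) * p' - (a * p' + q') * p\<bar> = 1"
    using *(3) by simp
  have pos: "1 < \<alpha> \<longrightarrow> 1 \<le> a * p + q \<and> 0 \<le> a * p' + q'"
  proof
    assume "1 < \<alpha>"
    then have "0 \<le> a"
      by (simp add: a_def)
    then have "0 \<le> a * p" "0 \<le> a * p'"
      using * by simp_all
    then show "1 \<le> a * p + q \<and> 0 \<le> a * p' + q'"
      using * by linarith
  qed
  have conv: "cf_convergent \<alpha> (Suc l) = of_int (a * p + q) / of_int p"
    using * by (simp add: cf_convergent_Suc_front flip: \<beta>_def a_def) (simp add: field_simps)
  have "\<alpha> * (x * of_int p + of_int p') = \<alpha> * \<beta> * (x * of_int q + of_int q')"
    using *(8) by simp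
  also have "\<alpha> * \<beta> = of_int a * \<beta> + 1"
    using \<beta>(2) by (simp add: \<alpha> algebra_simps)
  also have "(of_int a * \<beta> + 1) * (x * of_int q + of_int q')
      = of_int a * (\<beta> * (x * of_int q + of_int q')) + (x * of_int q + of_int q')"
    by (simp add: algebra_simps)
  also have "\<dots> = x * of_int (a * p + q) + of_int (a * p' + q')"
    unfolding *(8) by (simp add: algebra_simps)
  finally show ?case
    using det pos conv *(4,5,7) by blast
qed

text \<open>
  The unimodular relation makes the fraction \<open>p/q\<close> reduced, so \<open>q\<close> is indeed the denominator in lowest
  terms, and it gives \<open>\<bar>\<alpha> - p/q\<bar> = 1 / (q(xq + q'))\<close>, where \<open>xq + q' \<ge> q\<close>.
\<close>

lemma cf_denom_approximation:
  assumes "\<alpha> \<notin> \<rat>"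
  obtains p :: int where "0 < cf_denom \<alpha> l" "coprime p (cf_denom \<alpha> l)"
    "\<bar>\<alpha> - of_int p / of_int (cf_denom \<alpha> l)\<bar> \<le> 1 / of_int (cf_denom \<alpha> l) ^ 2"
proof -
  from cf_convergent_moebius[OF assms, of l] obtain p q p' q' :: int and x :: real where
    *: "1 \<le> q" "0 \<le> q'" "\<bar>p * q' - p' * q\<bar> = 1"
       "cf_convergent \<alpha> l = of_int p / of_int q" "1 < x"
       "\<alpha> * (x * of_int q + of_int q') = x * of_int p + of_int p'"
    by blast
  have cop: "coprime p q"
  proof (rule coprimeI)
    fix d assume "d dvd p" "d dvd q"
    then have "d dvd \<bar>p * q' - p' * q\<bar>"
      by simp
    then show "is_unit d"
      using *(3) by simp
  qed
  have "quotient_of (cf_convergent \<alpha> l) = (p, q)"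
    using *(1,4) cop by (simp add: quotient_of_Fract normalize_stable flip: Fract_of_int_quotient)
  then have denom: "cf_denom \<alpha> l = q"
    by (simp add: cf_denom_def)
  define y where "y = x * of_int q + of_int q'"
  have q0: "(0::real) < of_int q"
    using *(1) by simp
  have "1 * of_int q \<le> x * of_int q"
    using *(5) q0 by (intro mult_right_mono) auto
  then have y: "of_int q \<le> y"
    using *(2) by (simp add: y_def)
  have "(\<alpha> - of_int p / of_int q) * (y * of_int q)
      = \<alpha> * y * of_int q - of_int p * y"
    using q0 by (simp add: field_simps)
  also have "\<dots> = of_int (p' * q - p * q')"
    unfolding y_def *(6) by (simp add: algebra_simps)
  also have "\<bar>\<dots>\<bar> = 1"
    using *(3) by linarith
  finally have "\<bar>\<alpha> - of_int p / of_int q\<bar> * (y * of_int q) = 1"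
    using y q0 by (simp add: abs_mult)
  then have "\<bar>\<alpha> - of_int p / of_int q\<bar> = 1 / (y * of_int q)"
    using y q0 by (simp add: field_simps)
  also have "\<dots> \<le> 1 / (of_int q * of_int q)"
    using y q0 by (intro divide_left_mono mult_right_mono mult_pos_pos) auto
  finally show ?thesis
    using that[of p] *(1) cop by (simp add: denom power2_eq_square)
qed

section \<open>The two-sided estimate\<close>

theorem lemma6p1:
  fixes \<alpha> \<epsilon> :: real and N :: nat
  assumes "\<alpha> \<notin> \<rat>"
    and "\<epsilon> > 0"
    and "0 < 2 * \<epsilon>"
    and "2 * \<epsilon> < dist_nearest_int (of_int (cf_denom \<alpha> 2) * \<alpha>)"
    and "\<exists>l::nat. 1 / (2 * \<epsilon>) \<le> of_int (cf_denom \<alpha> l) \<and> cf_denom \<alpha> l \<le> int N"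
  shows "\<lfloor>\<epsilon> * real N\<rfloor> \<le> int (card {n::nat. 1 \<le> n \<and> n \<le> N \<and> dist_nearest_int (real n * \<alpha>) < \<epsilon>})
    \<and> real (card {n::nat. 1 \<le> n \<and> n \<le> N \<and> dist_nearest_int (real n * \<alpha>) < \<epsilon>}) \<le> 32 * \<epsilon> * real N"
proof
  have "\<epsilon> \<le> 1"
    using assms(2,4) dist_nearest_int_le_half[of "of_int (cf_denom \<alpha> 2) * \<alpha>"] by linarith
  then show "\<lfloor>\<epsilon> * real N\<rfloor> \<le> int (card {n::nat. 1 \<le> n \<and> n \<le> N \<and> dist_nearest_int (real n * \<alpha>) < \<epsilon>})"
    using card_near_return_times_ge[OF assms(2)] by blast
next
  obtain l where l: "1 / (2 * \<epsilon>) \<le> of_int (cf_denom \<alpha> l)" "cf_denom \<alpha> l \<le> int N"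
    using assms(5) by blast
  obtain p where p: "0 < cf_denom \<alpha> l" "coprime p (cf_denom \<alpha> l)"
    "\<bar>\<alpha> - of_int p / of_int (cf_denom \<alpha> l)\<bar> \<le> 1 / of_int (cf_denom \<alpha> l) ^ 2"
    using cf_denom_approximation[OF assms(1)] .
  obtain q where q: "cf_denom \<alpha> l = int q"
    using p(1) by (metis less_imp_le nonneg_int_cases)
  have "real (card {n::nat. 1 \<le> n \<and> n \<le> N \<and> dist_nearest_int (real n * \<alpha>) < \<epsilon>}) \<le> 12 * \<epsilon> * real N"
    using p l assms(2) unfolding q
    by (intro card_near_return_times_le[of p q]) (simp_all add: field_simps)
  also have "\<dots> \<le> 32 * \<epsilon> * real N"
    using assms(2) by (intro mult_right_mono) auto
  finally show "real (card {n::nat. 1 \<le> n \<and> n \<le> N \<and> dist_nearest_int (real n * \<alpha>) < \<epsilon>}) \<le> 32 * \<epsilon> * real N" .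
qed

end
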